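(* Let $N$ be a submodule of an $R$-module $M$, $J$ an ideal of $R$ and $S$ a multiplicatively closed subset of $R$. (1) $N$ is an $S$-prime submodule of $M$ if and only if $\overline{N}$ is an $\overline{S}$-prime submodule of $M\Join J$. (2) If $\overline{N}$ is an $\overline{S}$-prime submodule of $M\Join J$ and $(N:_{R}JM)\cap S=\emptyset$, then $(N:_{M}J)$ is an $S$-prime submodule of $M$.
   Context: Rings are commutative with non-zero identity and modules are unital. A non-empty subset of a ring is multiplicatively closed if it is closed under multiplication. For submodules $N,K$ of an $R$-module $M$, $(N:_{R}K)=\{r\in R: rK\subseteq N\}$; $(N:_{M}J)=\{m\in M: Jm\subseteq N\}$. Duplication: $R\Join J=\{(r,r+j):r\in R,j\in J\}$, a subring of $R\times R$. $M\Join J=\{(m,m^{\prime})\in M\times M:m-m^{\prime}\in JM\}$ is an $(R\Join J)$-module via $(r,r+j)(m,m^{\prime})=(rm,(r+j)m^{\prime})$. $\overline{N}=\{(m,n)\in M\times N:m-n\in JM\}$ is a submodule of $M\Join J$, and $\overline{S}=\{(r,r+j):r\in R,\ j\in J,\ r+j\in S\}$ is a multiplicatively closed subset of $R\Join J$. For a multiplicatively closed subset $T$ of a ring $R$, a submodule $N$ of an $R$-module $M$ with $(N:_{R}M)\cap T=\emptyset$ is $T$-prime if there exists a fixed $t\in T$ such that for all $a\in R$, $m\in M$ with $am\in N$, either $ta\in(N:_{R}M)$ or $tm\in N$. *)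

theory Defs
  imports "HOL-Algebra.Module" "HOL-Algebra.Subrings" "HOL-Algebra.Chinese_Remainder"
begin

text \<open>Unlike \<^locale>\<open>submonoid\<close>, a multiplicatively closed set need not contain the identity.\<close>

definition mult_closed :: "('a, 'c) ring_scheme \<Rightarrow> 'a set \<Rightarrow> bool" where
  "mult_closed R S \<longleftrightarrow>
     S \<subseteq> carrier R \<and> S \<noteq> {} \<and> (\<forall>s\<in>S. \<forall>t\<in>S. s \<otimes>\<^bsub>R\<^esub> t \<in> S)"

definition residual_ring ::
    "('a, 'c) ring_scheme \<Rightarrow> ('a, 'b, 'd) module_scheme \<Rightarrow> 'b set \<Rightarrow> 'b set \<Rightarrow> 'a set" where
  "residual_ring R M N K = {r \<in> carrier R. \<forall>k\<in>K. r \<odot>\<^bsub>M\<^esub> k \<in> N}"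

definition residual_module ::
    "('a, 'b, 'd) module_scheme \<Rightarrow> 'b set \<Rightarrow> 'a set \<Rightarrow> 'b set" where
  "residual_module M N J = {m \<in> carrier M. \<forall>j\<in>J. j \<odot>\<^bsub>M\<^esub> m \<in> N}"

text \<open>
  The submodule \<open>JM\<close> of finite sums of products, in the style of \<^const>\<open>ideal_prod\<close>.
  The empty sum needs no rule of its own, as \<open>J\<close> is an ideal and hence contains zero.
\<close>

inductive_set ideal_smult :: "'a set \<Rightarrow> ('a, 'b, 'd) module_scheme \<Rightarrow> 'b set"
  for J and M where
  prod: "\<lbrakk>j \<in> J; m \<in> carrier M\<rbrakk> \<Longrightarrow> j \<odot>\<^bsub>M\<^esub> m \<in> ideal_smult J M"
| sum: "\<lbrakk>x \<in> ideal_smult J M; y \<in> ideal_smult J M\<rbrakk> \<Longrightarrow> x \<oplus>\<^bsub>M\<^esub> y \<in> ideal_smult J M"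

definition T_prime_submodule ::
    "('a, 'c) ring_scheme \<Rightarrow> ('a, 'b, 'd) module_scheme \<Rightarrow> 'a set \<Rightarrow> 'b set \<Rightarrow> bool" where
  "T_prime_submodule R M T N \<longleftrightarrow>
     module R M \<and> submodule N R M \<and> mult_closed R T \<and>
     residual_ring R M N (carrier M) \<inter> T = {} \<and>
     (\<exists>t\<in>T. \<forall>a\<in>carrier R. \<forall>m\<in>carrier M. a \<odot>\<^bsub>M\<^esub> m \<in> N \<longrightarrow>
        t \<otimes>\<^bsub>R\<^esub> a \<in> residual_ring R M N (carrier M) \<or> t \<odot>\<^bsub>M\<^esub> m \<in> N)"

definition dup_ring :: "('a, 'c) ring_scheme \<Rightarrow> 'a set \<Rightarrow> ('a \<times> 'a) ring" where
  "dup_ring R J =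
     (RDirProd R R)\<lparr>carrier := {(r, r \<oplus>\<^bsub>R\<^esub> j) | r j. r \<in> carrier R \<and> j \<in> J}\<rparr>"

text \<open>
  The record type of modules extends that of rings; the fields \<^const>\<open>mult\<close> and
  \<^const>\<open>one\<close> play no role for modules and are left unspecified.
\<close>

definition dup_module ::
    "('a, 'b, 'd) module_scheme \<Rightarrow> 'a set \<Rightarrow> ('a \<times> 'a, 'b \<times> 'b) module" where
  "dup_module M J =
     \<lparr>carrier = {(m, m'). m \<in> carrier M \<and> m' \<in> carrier M \<and> m \<ominus>\<^bsub>M\<^esub> m' \<in> ideal_smult J M},
      mult = undefined,
      one = undefined,
      zero = (\<zero>\<^bsub>M\<^esub>, \<zero>\<^bsub>M\<^esub>),
      add = (\<lambda>(m, m') (n, n'). (m \<oplus>\<^bsub>M\<^esub> n, m' \<oplus>\<^bsub>M\<^esub> n')),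
      smult = (\<lambda>(r, s) (m, m'). (r \<odot>\<^bsub>M\<^esub> m, s \<odot>\<^bsub>M\<^esub> m'))\<rparr>"

definition dup_submodule ::
    "('a, 'b, 'd) module_scheme \<Rightarrow> 'a set \<Rightarrow> 'b set \<Rightarrow> ('b \<times> 'b) set" where
  "dup_submodule M J N =
     {(m, n). m \<in> carrier M \<and> n \<in> N \<and> m \<ominus>\<^bsub>M\<^esub> n \<in> ideal_smult J M}"

definition dup_set ::
    "('a, 'c) ring_scheme \<Rightarrow> 'a set \<Rightarrow> 'a set \<Rightarrow> ('a \<times> 'a) set" where
  "dup_set R J S =
     {(r, r \<oplus>\<^bsub>R\<^esub> j) | r j. r \<in> carrier R \<and> j \<in> J \<and> r \<oplus>\<^bsub>R\<^esub> j \<in> S}"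

lemma RDirProd_simps:
  "x \<otimes>\<^bsub>RDirProd R S\<^esub> y = (fst x \<otimes>\<^bsub>R\<^esub> fst y, snd x \<otimes>\<^bsub>S\<^esub> snd y)"
  "x \<oplus>\<^bsub>RDirProd R S\<^esub> y = (fst x \<oplus>\<^bsub>R\<^esub> fst y, snd x \<oplus>\<^bsub>S\<^esub> snd y)"
  "\<one>\<^bsub>RDirProd R S\<^esub> = (\<one>\<^bsub>R\<^esub>, \<one>\<^bsub>S\<^esub>)"
  "\<zero>\<^bsub>RDirProd R S\<^esub> = (\<zero>\<^bsub>R\<^esub>, \<zero>\<^bsub>S\<^esub>)"
  by (simp_all add: RDirProd_def DirProd_def monoid.defs case_prod_beta)

lemma dup_ring_carrier_iff:
  fixes R (structure)
  assumes "cring R" "ideal J R"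
  shows "(r, s) \<in> carrier (dup_ring R J) \<longleftrightarrow>
    r \<in> carrier R \<and> s \<in> carrier R \<and> s \<ominus>\<^bsub>R\<^esub> r \<in> J"
proof -
  interpret cring R by fact
  interpret J: ideal J R by fact
  have "s = r \<oplus> (s \<ominus> r)" if "r \<in> carrier R" "s \<in> carrier R"
    using that by algebra
  moreover have "(r \<oplus> j) \<ominus> r = j" if "r \<in> carrier R" "j \<in> J"
    using that J.Icarr[OF that(2)] by algebra
  ultimately show ?thesis
    using J.Icarr by (fastforce simp: dup_ring_def)
qed

lemma dup_ring_subring:
  fixes R (structure)
  assumes "cring R" "ideal J R"
  shows "subring (carrier (dup_ring R J)) (RDirProd R R)"
proof -
  interpret cring R by fact
  interpret J: ideal J R by fact
  interpret P: ring "RDirProd R R"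
    using RDirProd_ring ring_axioms by blast
  have inv: "\<ominus>\<^bsub>RDirProd R R\<^esub> (a, b) = (\<ominus> a, \<ominus> b)" if "a \<in> carrier R" "b \<in> carrier R" for a b
    using that by (intro P.minus_equality) (auto simp: RDirProd_simps RDirProd_carrier l_neg)
  note iff = dup_ring_carrier_iff[OF assms]
  show ?thesis
  proof (rule P.subringI)
    show "carrier (dup_ring R J) \<subseteq> carrier (RDirProd R R)"
      by (auto simp: iff RDirProd_carrier)
    have "\<one> \<ominus> \<one> \<in> J" by (simp add: minus_eq r_neg)
    then show "\<one>\<^bsub>RDirProd R R\<^esub> \<in> carrier (dup_ring R J)"
      by (simp add: RDirProd_simps iff)
  next
    fix h assume "h \<in> carrier (dup_ring R J)"
    moreover obtain a b where h: "h = (a, b)" by fastforce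
    ultimately have ab: "a \<in> carrier R" "b \<in> carrier R" "b \<ominus> a \<in> J" by (auto simp: iff)
    have "\<ominus> b \<ominus> (\<ominus> a) = \<ominus> (b \<ominus> a)" using ab(1,2) by algebra
    then show "\<ominus>\<^bsub>RDirProd R R\<^esub> h \<in> carrier (dup_ring R J)"
      using ab by (simp add: h inv iff)
  next
    fix h k assume "h \<in> carrier (dup_ring R J)" "k \<in> carrier (dup_ring R J)"
    moreover obtain a b c d where h: "h = (a, b)" "k = (c, d)" by fastforce
    ultimately have ab: "a \<in> carrier R" "b \<in> carrier R" "c \<in> carrier R" "d \<in> carrier R"
      and J: "b \<ominus> a \<in> J" "d \<ominus> c \<in> J" by (auto simp: iff)
    have "b \<otimes> d \<ominus> a \<otimes> c = b \<otimes> (d \<ominus> c) \<oplus> (b \<ominus> a) \<otimes> c"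
      "(b \<oplus> d) \<ominus> (a \<oplus> c) = (b \<ominus> a) \<oplus> (d \<ominus> c)" using ab by algebra+
    then show "h \<otimes>\<^bsub>RDirProd R R\<^esub> k \<in> carrier (dup_ring R J)"
      "h \<oplus>\<^bsub>RDirProd R R\<^esub> k \<in> carrier (dup_ring R J)"
      using ab J by (simp_all add: h RDirProd_simps iff J.I_l_closed J.I_r_closed)
  qed
qed

lemma dup_ring_eq: "dup_ring R J = (RDirProd R R)\<lparr>carrier := carrier (dup_ring R J)\<rparr>"
  by (simp add: dup_ring_def)

lemma dup_ring_simps:
  "x \<otimes>\<^bsub>dup_ring R J\<^esub> y = (fst x \<otimes>\<^bsub>R\<^esub> fst y, snd x \<otimes>\<^bsub>R\<^esub> snd y)"
  "x \<oplus>\<^bsub>dup_ring R J\<^esub> y = (fst x \<oplus>\<^bsub>R\<^esub> fst y, snd x \<oplus>\<^bsub>R\<^esub> snd y)"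
  "\<one>\<^bsub>dup_ring R J\<^esub> = (\<one>\<^bsub>R\<^esub>, \<one>\<^bsub>R\<^esub>)"
  "\<zero>\<^bsub>dup_ring R J\<^esub> = (\<zero>\<^bsub>R\<^esub>, \<zero>\<^bsub>R\<^esub>)"
  by (simp_all add: dup_ring_def RDirProd_simps)

lemma dup_ring_cring:
  assumes "cring R" "ideal J R"
  shows "cring (dup_ring R J)"
proof -
  interpret cring R by fact
  interpret P: ring "RDirProd R R"
    using RDirProd_ring ring_axioms by blast
  have "ring (dup_ring R J)"
    using P.subring_is_ring[OF dup_ring_subring[OF assms]] dup_ring_eq[of R J] by simp
  then interpret D: ring "dup_ring R J" .
  show ?thesis
    by unfold_locales (auto simp: dup_ring_simps dup_ring_carrier_iff[OF assms] m_comm)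
qed

lemma ideal_smult_submodule:
  fixes R (structure)
  assumes "module R M" "ideal J R"
  shows "submodule (ideal_smult J M) R M"
proof -
  interpret module R M by fact
  interpret J: ideal J R by fact
  have sub: "x \<in> carrier M" if "x \<in> ideal_smult J M" for x
    using that by induction (auto simp: J.Icarr)
  show ?thesis
  proof (rule submoduleI)
    show "\<zero>\<^bsub>M\<^esub> \<in> ideal_smult J M"
      using ideal_smult.prod[of \<zero> J "\<zero>\<^bsub>M\<^esub>" M] by simp
    show smult: "a \<odot>\<^bsub>M\<^esub> x \<in> ideal_smult J M"
      if "a \<in> carrier R" "x \<in> ideal_smult J M" for a x
      using that(2)
    proof induction
      case (prod j m)
      then show ?case
        using ideal_smult.prod[of "a \<otimes> j" J m M] that(1)
        by (simp add: smult_assoc1 J.Icarr J.I_l_closed)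
    qed (use that(1) sub in \<open>auto simp: smult_r_distr intro: ideal_smult.sum\<close>)
    show "\<ominus>\<^bsub>M\<^esub> x \<in> ideal_smult J M" if "x \<in> ideal_smult J M" for x
      using smult[of "\<ominus> \<one>" x] that sub by (simp add: smult_l_minus)
  qed (auto simp: sub intro: ideal_smult.sum)
qed

lemma dup_module_simps:
  "(m, m') \<in> carrier (dup_module M J) \<longleftrightarrow>
     m \<in> carrier M \<and> m' \<in> carrier M \<and> m \<ominus>\<^bsub>M\<^esub> m' \<in> ideal_smult J M"
  "x \<oplus>\<^bsub>dup_module M J\<^esub> y = (fst x \<oplus>\<^bsub>M\<^esub> fst y, snd x \<oplus>\<^bsub>M\<^esub> snd y)"
  "\<zero>\<^bsub>dup_module M J\<^esub> = (\<zero>\<^bsub>M\<^esub>, \<zero>\<^bsub>M\<^esub>)"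
  "p \<odot>\<^bsub>dup_module M J\<^esub> x = (fst p \<odot>\<^bsub>M\<^esub> fst x, snd p \<odot>\<^bsub>M\<^esub> snd x)"
  by (simp_all add: dup_module_def case_prod_beta)

lemma dup_module_closed:
  fixes R (structure)
  assumes "module R M" "ideal J R"
  shows "\<lbrakk>a \<in> carrier M; b \<in> carrier M; c \<in> carrier M; d \<in> carrier M;
      a \<ominus>\<^bsub>M\<^esub> b \<in> ideal_smult J M; c \<ominus>\<^bsub>M\<^esub> d \<in> ideal_smult J M\<rbrakk>
      \<Longrightarrow> (a \<oplus>\<^bsub>M\<^esub> c) \<ominus>\<^bsub>M\<^esub> (b \<oplus>\<^bsub>M\<^esub> d) \<in> ideal_smult J M"
    and "\<lbrakk>a \<in> carrier M; b \<in> carrier M; a \<ominus>\<^bsub>M\<^esub> b \<in> ideal_smult J M\<rbrakk>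
      \<Longrightarrow> (\<ominus>\<^bsub>M\<^esub> a) \<ominus>\<^bsub>M\<^esub> (\<ominus>\<^bsub>M\<^esub> b) \<in> ideal_smult J M"
    and "\<lbrakk>(r, s) \<in> carrier (dup_ring R J); a \<in> carrier M; b \<in> carrier M;
      a \<ominus>\<^bsub>M\<^esub> b \<in> ideal_smult J M\<rbrakk>
      \<Longrightarrow> (r \<odot>\<^bsub>M\<^esub> a) \<ominus>\<^bsub>M\<^esub> (s \<odot>\<^bsub>M\<^esub> b) \<in> ideal_smult J M"
proof -
  interpret module R M by fact
  interpret J: ideal J R by fact
  note sub = submoduleE[OF ideal_smult_submodule[OF assms]]
  note ac = M.minus_eq M.minus_add M.a_ac M.minus_minus
  { assume c: "a \<in> carrier M" "b \<in> carrier M" "c \<in> carrier M" "d \<in> carrier M"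
      and "a \<ominus>\<^bsub>M\<^esub> b \<in> ideal_smult J M" "c \<ominus>\<^bsub>M\<^esub> d \<in> ideal_smult J M"
    then have "(a \<ominus>\<^bsub>M\<^esub> b) \<oplus>\<^bsub>M\<^esub> (c \<ominus>\<^bsub>M\<^esub> d) \<in> ideal_smult J M" by (blast intro: sub(5))
    with c show "(a \<oplus>\<^bsub>M\<^esub> c) \<ominus>\<^bsub>M\<^esub> (b \<oplus>\<^bsub>M\<^esub> d) \<in> ideal_smult J M"
      by (simp add: ac) }
  { assume c: "a \<in> carrier M" "b \<in> carrier M" and "a \<ominus>\<^bsub>M\<^esub> b \<in> ideal_smult J M"
    then have "\<ominus>\<^bsub>M\<^esub> (a \<ominus>\<^bsub>M\<^esub> b) \<in> ideal_smult J M" by (blast intro: sub(3))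
    with c show "(\<ominus>\<^bsub>M\<^esub> a) \<ominus>\<^bsub>M\<^esub> (\<ominus>\<^bsub>M\<^esub> b) \<in> ideal_smult J M"
      by (simp add: ac) }
  { assume rs: "(r, s) \<in> carrier (dup_ring R J)" and c: "a \<in> carrier M" "b \<in> carrier M"
      and ab: "a \<ominus>\<^bsub>M\<^esub> b \<in> ideal_smult J M"
    have r: "r \<in> carrier R" "s \<in> carrier R" "s \<ominus> r \<in> J"
      using rs dup_ring_carrier_iff[OF is_cring assms(2)] by auto
    have "r \<odot>\<^bsub>M\<^esub> (a \<ominus>\<^bsub>M\<^esub> b) \<oplus>\<^bsub>M\<^esub> \<ominus>\<^bsub>M\<^esub> ((s \<ominus> r) \<odot>\<^bsub>M\<^esub> b) \<in> ideal_smult J M"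
      using r c ab by (intro sub(3,4,5) ideal_smult.prod)
    also have "r \<odot>\<^bsub>M\<^esub> (a \<ominus>\<^bsub>M\<^esub> b) \<oplus>\<^bsub>M\<^esub> \<ominus>\<^bsub>M\<^esub> ((s \<ominus> r) \<odot>\<^bsub>M\<^esub> b) =
      (r \<odot>\<^bsub>M\<^esub> a \<ominus>\<^bsub>M\<^esub> s \<odot>\<^bsub>M\<^esub> b) \<oplus>\<^bsub>M\<^esub> (r \<odot>\<^bsub>M\<^esub> b \<oplus>\<^bsub>M\<^esub> \<ominus>\<^bsub>M\<^esub> (r \<odot>\<^bsub>M\<^esub> b))"
      using r(1,2) c
      by (simp add: R.minus_eq smult_l_distr smult_r_distr smult_l_minus smult_r_minus ac
          del: M.r_neg M.add.r_inv)
    also have "\<dots> = r \<odot>\<^bsub>M\<^esub> a \<ominus>\<^bsub>M\<^esub> s \<odot>\<^bsub>M\<^esub> b"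
      using r(1,2) c by (simp add: M.r_neg)
    finally show "(r \<odot>\<^bsub>M\<^esub> a) \<ominus>\<^bsub>M\<^esub> (s \<odot>\<^bsub>M\<^esub> b) \<in> ideal_smult J M" . }
qed

lemma dup_module_module:
  assumes "module R M" "ideal J R"
  shows "module (dup_ring R J) (dup_module M J)"
proof -
  interpret module R M by fact
  note iff = dup_ring_carrier_iff[OF is_cring assms(2)]
  note sub = submoduleE[OF ideal_smult_submodule[OF assms]]
  have zero: "\<zero>\<^bsub>M\<^esub> \<ominus>\<^bsub>M\<^esub> \<zero>\<^bsub>M\<^esub> \<in> ideal_smult J M"
    using submodule.axioms(1)[OF ideal_smult_submodule[OF assms], THEN subgroup.one_closed]
    by (metis M.minus_eq M.r_neg M.zero_closed monoid.select_convs(2))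
  show ?thesis
  proof (rule moduleI)
    show "cring (dup_ring R J)" using dup_ring_cring[OF is_cring assms(2)] .
    show "abelian_group (dup_module M J)"
    proof (rule abelian_groupI)
      fix x assume "x \<in> carrier (dup_module M J)"
      then show "\<exists>y\<in>carrier (dup_module M J). y \<oplus>\<^bsub>dup_module M J\<^esub> x = \<zero>\<^bsub>dup_module M J\<^esub>"
        by (intro bexI[of _ "(\<ominus>\<^bsub>M\<^esub> fst x, \<ominus>\<^bsub>M\<^esub> snd x)"]; cases x)
          (auto simp: dup_module_simps M.l_neg dup_module_closed(2)[OF assms])
    qed (auto simp: dup_module_simps zero dup_module_closed(1)[OF assms] M.a_ac)
  qed (auto simp: dup_module_simps dup_ring_simps iff dup_module_closed(3)[OF assms]
      smult_l_distr smult_r_distr smult_assoc1)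
qed

lemma dup_submodule_submodule:
  assumes "module R M" "ideal J R" "submodule N R M"
  shows "submodule (dup_submodule M J N) (dup_ring R J) (dup_module M J)"
proof -
  interpret module R M by fact
  interpret D: module "dup_ring R J" "dup_module M J" using dup_module_module[OF assms(1,2)] .
  note iff = dup_ring_carrier_iff[OF is_cring assms(2)]
  note N = submoduleE[OF assms(3)]
  have zeroN: "\<zero>\<^bsub>M\<^esub> \<in> N"
    using submodule.axioms(1)[OF assms(3), THEN subgroup.one_closed] by simp
  have eq: "(m, n) \<in> dup_submodule M J N \<longleftrightarrow> (m, n) \<in> carrier (dup_module M J) \<and> n \<in> N" for m n
    using N(1) by (auto simp: dup_submodule_def dup_module_simps)
  have inv: "\<ominus>\<^bsub>dup_module M J\<^esub> (a, b) = (\<ominus>\<^bsub>M\<^esub> a, \<ominus>\<^bsub>M\<^esub> b)"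
    if "(a, b) \<in> carrier (dup_module M J)" for a b
    using that by (intro D.M.minus_equality)
      (auto simp: dup_module_simps M.l_neg dup_module_closed(2)[OF assms(1,2)])
  show ?thesis
  proof (rule D.submoduleI)
    show "dup_submodule M J N \<subseteq> carrier (dup_module M J)" by (auto simp: eq)
    show "\<zero>\<^bsub>dup_module M J\<^esub> \<in> dup_submodule M J N"
      using D.M.zero_closed zeroN by (simp add: eq dup_module_simps(3))
  next
    fix x assume "x \<in> dup_submodule M J N"
    then show "\<ominus>\<^bsub>dup_module M J\<^esub> x \<in> dup_submodule M J N"
      using D.M.a_inv_closed[of x] inv[of "fst x" "snd x"] N(3)
      by (cases x) (auto simp: eq dup_module_simps(1) dup_module_closed(2)[OF assms(1,2)])
  next
    fix x y assume "x \<in> dup_submodule M J N" "y \<in> dup_submodule M J N"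
    then show "x \<oplus>\<^bsub>dup_module M J\<^esub> y \<in> dup_submodule M J N"
      using D.M.add.m_closed[of x y] N(5)
      by (cases x; cases y) (auto simp: eq dup_module_simps(2))
  next
    fix p x assume "p \<in> carrier (dup_ring R J)" "x \<in> dup_submodule M J N"
    then show "p \<odot>\<^bsub>dup_module M J\<^esub> x \<in> dup_submodule M J N"
      using D.smult_closed[of p x] N(4)
      by (cases p; cases x) (auto simp: eq dup_module_simps(4) iff)
  qed
qed

lemma dup_set_mult_closed:
  assumes "cring R" "ideal J R" "mult_closed R S"
  shows "mult_closed (dup_ring R J) (dup_set R J S)"
proof -
  interpret cring R by fact
  interpret J: ideal J R by fact
  interpret D: cring "dup_ring R J" using dup_ring_cring[OF assms(1,2)] .
  have eq: "p \<in> dup_set R J S \<longleftrightarrow> p \<in> carrier (dup_ring R J) \<and> snd p \<in> S" for p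
    by (auto simp: dup_set_def dup_ring_def)
  obtain s where s: "s \<in> S" "s \<in> carrier R"
    using assms(3) by (auto simp: mult_closed_def)
  then have "(s, s) \<in> dup_set R J S"
    by (simp add: eq dup_ring_carrier_iff[OF assms(1,2)] minus_eq r_neg)
  then have "dup_set R J S \<noteq> {}" by blast
  moreover have "p \<otimes>\<^bsub>dup_ring R J\<^esub> q \<in> dup_set R J S"
    if "p \<in> dup_set R J S" "q \<in> dup_set R J S" for p q
    using that assms(3) D.m_closed[of p q] by (auto simp: eq mult_closed_def dup_ring_simps(1))
  ultimately show ?thesis by (auto simp: mult_closed_def eq)
qed

end

theory Submission
  imports Defs
begin

text \<open>
  The second projections \<open>R \<Join> J \<rightarrow> R\<close> and \<open>M \<Join> J \<rightarrow> M\<close> are onto, because the diagonal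
  splits them, and they respect scalar multiplication. The sets \<open>S\<close>-bar and \<open>N\<close>-bar are exactly
  the preimages of \<open>S\<close> and \<open>N\<close>. Being \<open>T\<close>-prime only speaks about products of scalars and
  vectors and about membership in \<open>T\<close> and \<open>N\<close>, so it transfers in both directions along such a pair
  of surjections (\<open>T_prime_submodule_preimage_iff\<close>). This is the first part.

  By the first part, the second part concerns an \<open>S\<close>-prime submodule \<open>N\<close>, with witness \<open>t\<close> say.
  If \<open>a m\<close> lies in \<open>(N : J)\<close>, then \<open>a (j m)\<close> lies in \<open>N\<close> for each \<open>j\<close> in \<open>J\<close>. The alternative
  \<open>t a M \<subseteq> N\<close> does not mention \<open>j\<close>, so either it holds, or \<open>t (j m)\<close> lies in \<open>N\<close> for all \<open>j\<close> at
  once, that is, \<open>t m\<close> lies in \<open>(N : J)\<close>. The same \<open>t\<close> therefore serves for \<open>(N : J)\<close>. The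
  disjointness condition carries over because \<open>((N : J) : M) = (N : JM)\<close>
  (\<open>residual_ring_residual_module\<close>).
\<close>

lemma residual_ring_preimage_iff:
  assumes g: "g ` carrier M' = carrier M"
    and smult: "\<And>p x. p \<in> carrier R' \<Longrightarrow> x \<in> carrier M' \<Longrightarrow>
      g (p \<odot>\<^bsub>M'\<^esub> x) = f p \<odot>\<^bsub>M\<^esub> g x"
    and "module R' M'" and p: "p \<in> carrier R'" and "f p \<in> carrier R"
  shows "p \<in> residual_ring R' M' {x \<in> carrier M'. g x \<in> N} (carrier M') \<longleftrightarrow>
    f p \<in> residual_ring R M N (carrier M)"
proof -
  interpret M': module R' M' by fact
  show ?thesis
    using p assms(5) by (simp add: residual_ring_def smult flip: g)
qed

text \<open>
  Surjectivity makes the quantifiers over \<open>R'\<close>, \<open>M'\<close> and the preimage of \<open>T\<close> range over \<open>R\<close>, \<open>M\<close>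
  and \<open>T\<close>, and the bodies of the two definitions agree under \<open>f\<close> and \<open>g\<close>. The image
  of a witness is a witness, and so is every preimage of one.
\<close>

lemma T_prime_submodule_preimage_iff:
  assumes "module R M" "submodule N R M" "mult_closed R T"
    and "module R' M'" "submodule {x \<in> carrier M'. g x \<in> N} R' M'"
    and "mult_closed R' {p \<in> carrier R'. f p \<in> T}"
    and f: "f ` carrier R' = carrier R"
    and g: "g ` carrier M' = carrier M"
    and mult: "\<And>p q. p \<in> carrier R' \<Longrightarrow> q \<in> carrier R' \<Longrightarrow>
      f (p \<otimes>\<^bsub>R'\<^esub> q) = f p \<otimes>\<^bsub>R\<^esub> f q"
    and smult: "\<And>p x. p \<in> carrier R' \<Longrightarrow> x \<in> carrier M' \<Longrightarrow>
      g (p \<odot>\<^bsub>M'\<^esub> x) = f p \<odot>\<^bsub>M\<^esub> g x"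
  shows "T_prime_submodule R' M' {p \<in> carrier R'. f p \<in> T} {x \<in> carrier M'. g x \<in> N} \<longleftrightarrow>
    T_prime_submodule R M T N"
proof -
  interpret M': module R' M' by fact
  let ?N' = "{x \<in> carrier M'. g x \<in> N}" and ?T' = "{p \<in> carrier R'. f p \<in> T}"
  have fc: "f p \<in> carrier R" if "p \<in> carrier R'" for p
    using that f by blast
  note res = residual_ring_preimage_iff[OF g smult assms(4) _ fc]
  have T: "T = f ` ?T'"
    using f assms(3) by (fastforce simp: mult_closed_def)
  have "residual_ring R M N (carrier M) \<inter> T = {} \<longleftrightarrow>
      (\<forall>p\<in>?T'. f p \<notin> residual_ring R M N (carrier M))"
    by (subst T) blast
  also have "\<dots> \<longleftrightarrow> residual_ring R' M' ?N' (carrier M') \<inter> ?T' = {}"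
    using res by blast
  finally have disj: "residual_ring R' M' ?N' (carrier M') \<inter> ?T' = {} \<longleftrightarrow>
    residual_ring R M N (carrier M) \<inter> T = {}" ..
  let ?prime = "\<lambda>t. \<forall>a\<in>carrier R. \<forall>m\<in>carrier M. a \<odot>\<^bsub>M\<^esub> m \<in> N \<longrightarrow>
    t \<otimes>\<^bsub>R\<^esub> a \<in> residual_ring R M N (carrier M) \<or> t \<odot>\<^bsub>M\<^esub> m \<in> N"
  let ?prime' = "\<lambda>t. \<forall>a\<in>carrier R'. \<forall>m\<in>carrier M'. a \<odot>\<^bsub>M'\<^esub> m \<in> ?N' \<longrightarrow>
    t \<otimes>\<^bsub>R'\<^esub> a \<in> residual_ring R' M' ?N' (carrier M') \<or> t \<odot>\<^bsub>M'\<^esub> m \<in> ?N'"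
  have "?prime' t \<longleftrightarrow> ?prime (f t)" if "t \<in> carrier R'" for t
    unfolding f[symmetric] g[symmetric] ball_simps
    using that by (intro ball_cong refl) (simp add: res[unfolded g[symmetric]] mult smult)
  then have "(\<exists>t\<in>?T'. ?prime' t) \<longleftrightarrow> (\<exists>t\<in>?T'. ?prime (f t))"
    by blast
  also have "\<dots> \<longleftrightarrow> (\<exists>t\<in>T. ?prime t)"
    by (subst (2) T) blast
  finally show ?thesis
    using assms(1-6) disj by (simp only: T_prime_submodule_def simp_thms)
qed

lemma fst_snd_in_dup_ring:
  assumes "cring R" "ideal J R" "p \<in> carrier (dup_ring R J)"
  shows "fst p \<in> carrier R" "snd p \<in> carrier R"
  using assms dup_ring_carrier_iff[OF assms(1,2), of "fst p" "snd p"] by auto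

lemma snd_image_dup_ring:
  assumes "cring R" "ideal J R"
  shows "snd ` carrier (dup_ring R J) = carrier R"
proof -
  interpret cring R by fact
  interpret J: ideal J R by fact
  have "(r, r) \<in> carrier (dup_ring R J)" if "r \<in> carrier R" for r
    using that by (simp add: dup_ring_carrier_iff[OF assms] minus_eq r_neg)
  then show ?thesis
    using fst_snd_in_dup_ring[OF assms] by force
qed

lemma snd_image_dup_module:
  assumes "module R M" "ideal J R"
  shows "snd ` carrier (dup_module M J) = carrier M"
proof -
  interpret module R M by fact
  have "\<zero>\<^bsub>M\<^esub> \<in> ideal_smult J M"
    using submodule.axioms(1)[OF ideal_smult_submodule[OF assms], THEN subgroup.one_closed]
    by simp
  then have "(m, m) \<in> carrier (dup_module M J)" if "m \<in> carrier M" for m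
    using that by (simp add: dup_module_simps M.minus_eq M.r_neg)
  then show ?thesis
    by (force simp: dup_module_def)
qed

lemma dup_set_eq_preimage: "dup_set R J S = {p \<in> carrier (dup_ring R J). snd p \<in> S}"
  by (auto simp: dup_set_def dup_ring_def)

lemma dup_submodule_eq_preimage:
  assumes "N \<subseteq> carrier M"
  shows "dup_submodule M J N = {x \<in> carrier (dup_module M J). snd x \<in> N}"
  using assms by (auto simp: dup_submodule_def dup_module_def)

lemma T_prime_submodule_dup_iff:
  assumes "module R M" "submodule N R M" "ideal J R" "mult_closed R S"
  shows "T_prime_submodule (dup_ring R J) (dup_module M J) (dup_set R J S) (dup_submodule M J N)
    \<longleftrightarrow> T_prime_submodule R M S N"
proof -
  interpret module R M by fact
  note N = dup_submodule_eq_preimage[OF submoduleE(1)[OF assms(2)], of J]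
  note S = dup_set_eq_preimage[of R J S]
  show ?thesis
    unfolding N S
    by (rule T_prime_submodule_preimage_iff)
      (use assms dup_module_module[OF assms(1,3)]
          dup_submodule_submodule[OF assms(1,3,2), unfolded N]
          dup_set_mult_closed[OF is_cring assms(3,4), unfolded S]
          snd_image_dup_ring[OF is_cring assms(3)] snd_image_dup_module[OF assms(1,3)]
        in \<open>simp_all add: dup_ring_simps dup_module_simps\<close>)
qed

lemma (in module) smult_left_commute:
  assumes "r \<in> carrier R" "s \<in> carrier R" "m \<in> carrier M"
  shows "r \<odot>\<^bsub>M\<^esub> (s \<odot>\<^bsub>M\<^esub> m) = s \<odot>\<^bsub>M\<^esub> (r \<odot>\<^bsub>M\<^esub> m)"
  using assms by (metis R.m_comm smult_assoc1)

lemma residual_module_submodule: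
  assumes "module R M" "submodule N R M" "J \<subseteq> carrier R"
  shows "submodule (residual_module M N J) R M"
proof -
  interpret module R M by fact
  note N = submoduleE[OF assms(2)]
  have zero: "\<zero>\<^bsub>M\<^esub> \<in> N"
    using submodule.axioms(1)[OF assms(2), THEN subgroup.one_closed] by simp
  have J: "j \<in> carrier R" if "j \<in> J" for j
    using that assms(3) by blast
  show ?thesis
    by (rule submoduleI)
      (auto simp: residual_module_def J zero N(3-5) smult_r_minus smult_r_distr smult_left_commute)
qed

text \<open>
  Every element of \<open>JM\<close> is a sum of products \<open>j m\<close>, so closure of \<open>N\<close> under addition reduces
  membership in \<open>(N : JM)\<close> to these generators.
\<close>

lemma residual_ring_residual_module:
  assumes "module R M" "submodule N R M" "ideal J R"
  shows "residual_ring R M (residual_module M N J) (carrier M)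
    = residual_ring R M N (ideal_smult J M)"
proof -
  interpret module R M by fact
  interpret J: ideal J R by fact
  note N = submoduleE[OF assms(2)]
  have sub: "x \<in> carrier M" if "x \<in> ideal_smult J M" for x
    using that submoduleE(1)[OF ideal_smult_submodule[OF assms(1,3)]] by blast
  have "(\<forall>x\<in>ideal_smult J M. r \<odot>\<^bsub>M\<^esub> x \<in> N) \<longleftrightarrow>
      (\<forall>m\<in>carrier M. \<forall>j\<in>J. r \<odot>\<^bsub>M\<^esub> (j \<odot>\<^bsub>M\<^esub> m) \<in> N)" (is "?L \<longleftrightarrow> ?R")
    if r: "r \<in> carrier R" for r
  proof
    assume ?L
    then show ?R by (auto intro: ideal_smult.prod)
  next
    assume R: ?R
    show ?L
    proof
      fix x assume "x \<in> ideal_smult J M"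
      then show "r \<odot>\<^bsub>M\<^esub> x \<in> N"
        by induction (use R r sub N(5) in \<open>auto simp: smult_r_distr\<close>)
    qed
  qed
  then show ?thesis
    by (simp add: residual_ring_def residual_module_def J.Icarr smult_left_commute cong: conj_cong)
qed

lemma T_prime_submodule_residual_module:
  assumes "T_prime_submodule R M S N" "ideal J R"
    and disj: "residual_ring R M N (ideal_smult J M) \<inter> S = {}"
  shows "T_prime_submodule R M S (residual_module M N J)"
proof -
  have M: "module R M" and N: "submodule N R M" and S: "mult_closed R S"
    using assms(1) by (auto simp: T_prime_submodule_def)
  interpret module R M by fact
  interpret J: ideal J R by fact
  obtain t where t: "t \<in> S" and prime: "\<And>a m. \<lbrakk>a \<in> carrier R; m \<in> carrier M; a \<odot>\<^bsub>M\<^esub> m \<in> N;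
      t \<otimes>\<^bsub>R\<^esub> a \<notin> residual_ring R M N (carrier M)\<rbrakk> \<Longrightarrow> t \<odot>\<^bsub>M\<^esub> m \<in> N"
    using assms(1) by (auto simp: T_prime_submodule_def)
  have tR: "t \<in> carrier R"
    using t S by (auto simp: mult_closed_def)
  have JM: "ideal_smult J M \<subseteq> carrier M"
    using submoduleE(1)[OF ideal_smult_submodule[OF M assms(2)]] .
  note res = residual_ring_residual_module[OF M N assms(2)]
  have "t \<otimes>\<^bsub>R\<^esub> a \<in> residual_ring R M N (ideal_smult J M) \<or> t \<odot>\<^bsub>M\<^esub> m \<in> residual_module M N J"
    if a: "a \<in> carrier R" and m: "m \<in> carrier M"
      and am: "a \<odot>\<^bsub>M\<^esub> m \<in> residual_module M N J" for a m
  proof (cases "t \<otimes>\<^bsub>R\<^esub> a \<in> residual_ring R M N (carrier M)")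
    case True
    then show ?thesis
      using JM by (auto simp: residual_ring_def)
  next
    case False
    have "t \<odot>\<^bsub>M\<^esub> (j \<odot>\<^bsub>M\<^esub> m) \<in> N" if "j \<in> J" for j
      using that a m am False J.Icarr
      by (intro prime[of a]) (auto simp: residual_module_def smult_left_commute)
    then show ?thesis
      using tR m by (simp add: residual_module_def J.Icarr smult_left_commute[OF _ tR m])
  qed
  moreover have "submodule (residual_module M N J) R M"
    using residual_module_submodule[OF M N] J.Icarr by blast
  ultimately show ?thesis
    using M S t disj by (auto simp: T_prime_submodule_def res)
qed

theorem corollary8:
  fixes R :: "('a, 'c) ring_scheme"
    and M :: "('a, 'b, 'd) module_scheme"
    and J S :: "'a set"
    and N :: "'b set"
  assumes "module R M"
    and "\<one>\<^bsub>R\<^esub> \<noteq> \<zero>\<^bsub>R\<^esub>"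
    and "submodule N R M"
    and "ideal J R"
    and "mult_closed R S"
  shows "(T_prime_submodule R M S N \<longleftrightarrow>
           T_prime_submodule (dup_ring R J) (dup_module M J) (dup_set R J S) (dup_submodule M J N))
       \<and> (T_prime_submodule (dup_ring R J) (dup_module M J) (dup_set R J S) (dup_submodule M J N)
            \<and> residual_ring R M N (ideal_smult J M) \<inter> S = {}
           \<longrightarrow> T_prime_submodule R M S (residual_module M N J))"
  using T_prime_submodule_dup_iff[OF assms(1,3,4,5)]
    T_prime_submodule_residual_module[OF _ assms(4)]
  by blast

end
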